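(* Let $M=\sum_{k=1}^\infty\sigma_kB^{H_k}$ be a multi-mixed fractional Brownian motion with parameters $\sigma_k,H_k$, $k\in\mathbb{N}$, let $U$ be the multi-mixed fractional Ornstein--Uhlenbeck process with parameter $\lambda>0$ driven by $M$, and let $H_{\inf}=\inf_kH_k$. Then both $M$ and $U$ have Hölder index $H_{\inf}$; that is, for every $T>0$, almost surely, $$\mathrm{Hol}_T(M)=\mathrm{Hol}_T(U)=H_{\inf}.$$
   Context: A two-sided fractional Brownian motion (fBm) with Hurst index $H\in(0,1)$ is a centered Gaussian process $(B^H_t)_{t\in\mathbb{R}}$ with continuous paths and covariance $\mathbb{E}[B^H_tB^H_s]=\frac12\left(|t|^{2H}+|s|^{2H}-|t-s|^{2H}\right)$. Multi-mixed fractional Brownian motion (mmfBm): let $\sigma_k>0$, $k\in\mathbb{N}$, satisfy $\sum_{k=1}^\infty\sigma_k^2<\infty$, and let $H_k\in(0,1)$, $k\in\mathbb{N}$, be pairwise distinct with $\inf_kH_k>0$ and $\sup_kH_k<1$. With independent two-sided fBm's $B^{H_k}$, put $M_t=\sum_{k=1}^\infty\sigma_kB^{H_k}_t$, $t\in\mathbb{R}$, the series converging in $L^2(\Omega)$ for each $t$; $M$ is taken in its continuous version. Multi-mixed fractional Ornstein--Uhlenbeck process (mmfOU) with parameter $\lambda>0$: the stationary solution of $\mathrm{d}U_t=-\lambda U_t\,\mathrm{d}t+\mathrm{d}M_t$, that is, $U_t=\int_{-\infty}^t\mathrm{e}^{-\lambda(t-s)}\,\mathrm{d}M_s=M_t-\lambda\int_{-\infty}^t\mathrm{e}^{-\lambda(t-s)}M_s\,\mathrm{d}s$.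 The Hölder index of a process $X$ on $[0,T]$ is $\mathrm{Hol}_T(X)=\sup\left\{a>0:\ \sup_{s,t\in[0,T],\,s\ne t}\frac{|X_t-X_s|}{|t-s|^a}<\infty\right\}$. *)

theory Defs
  imports "HOL-Probability.Probability"
begin

text \<open>Gaussian random variables are allowed to be degenerate (almost surely constant), as is
  needed for instance for the value at time \<open>0\<close> of a fractional Brownian motion.\<close>

definition gaussian_rv :: "'a measure \<Rightarrow> ('a \<Rightarrow> real) \<Rightarrow> bool" where
  "gaussian_rv P X \<longleftrightarrow>
     X \<in> borel_measurable P \<and>
     ((\<exists>\<mu> s. 0 < s \<and> distributed P lborel X (\<lambda>x. ennreal (normal_density \<mu> s x))) \<or>
      (\<exists>c. AE \<omega> in P. X \<omega> = c))"

definition gaussian_process :: "'a measure \<Rightarrow> (real \<Rightarrow> 'a \<Rightarrow> real) \<Rightarrow> bool" where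
  "gaussian_process P X \<longleftrightarrow>
     (\<forall>J c. finite J \<longrightarrow> gaussian_rv P (\<lambda>\<omega>. \<Sum>t\<in>J. c t * X t \<omega>))"

definition continuous_paths :: "'a measure \<Rightarrow> (real \<Rightarrow> 'a \<Rightarrow> real) \<Rightarrow> bool" where
  "continuous_paths P X \<longleftrightarrow> (\<forall>\<omega>\<in>space P. continuous_on UNIV (\<lambda>t. X t \<omega>))"

definition fBm :: "'a measure \<Rightarrow> real \<Rightarrow> (real \<Rightarrow> 'a \<Rightarrow> real) \<Rightarrow> bool" where
  "fBm P h B \<longleftrightarrow>
     0 < h \<and> h < 1 \<and>
     gaussian_process P B \<and>
     (\<forall>t. (LINT \<omega>|P. B t \<omega>) = 0) \<and>
     continuous_paths P B \<and>
     (\<forall>s t. (LINT \<omega>|P. B t \<omega> * B s \<omega>) =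
        (\<bar>t\<bar> powr (2 * h) + \<bar>s\<bar> powr (2 * h) - \<bar>t - s\<bar> powr (2 * h)) / 2)"

text \<open>The processes \<open>B k\<close> are independent as random elements of the path space
  \<open>\<real> \<rightarrow> \<real>\<close> with its product \<open>\<sigma>\<close>-algebra. The \<open>L\<^sup>2\<close> convergence of the
  series is expressed with the nonnegative integral, so that it has no integrability side
  condition.\<close>

definition mmfBm ::
  "'a measure \<Rightarrow> (nat \<Rightarrow> real) \<Rightarrow> (nat \<Rightarrow> real) \<Rightarrow> (nat \<Rightarrow> real \<Rightarrow> 'a \<Rightarrow> real) \<Rightarrow>
    (real \<Rightarrow> 'a \<Rightarrow> real) \<Rightarrow> bool" where
  "mmfBm P \<sigma> H B M \<longleftrightarrow>
     (\<forall>k. 0 < \<sigma> k) \<and> summable (\<lambda>k. (\<sigma> k)\<^sup>2) \<and>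
     (\<forall>k. 0 < H k \<and> H k < 1) \<and> inj H \<and> 0 < (INF k. H k) \<and> (SUP k. H k) < 1 \<and>
     (\<forall>k. fBm P (H k) (B k)) \<and>
     prob_space.indep_vars P (\<lambda>_. PiM UNIV (\<lambda>_. borel)) (\<lambda>k \<omega> t. B k t \<omega>) UNIV \<and>
     (\<forall>t. M t \<in> borel_measurable P) \<and>
     (\<forall>t. (\<lambda>n. \<integral>\<^sup>+ \<omega>. ennreal ((M t \<omega> - (\<Sum>k<n. \<sigma> k * B k t \<omega>))\<^sup>2) \<partial>P)
        \<longlonglongrightarrow> 0) \<and>
     continuous_paths P M"

text \<open>The stochastic integral \<open>\<integral>\<^bsub>-\<infinity>\<^esub>\<^bsup>t\<^esup> e\<^bsup>-\<lambda>(t-s)\<^esup> dM\<^sub>s\<close> in its pathwise form,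
  i.e. after integration by parts. For a multi-mixed fractional Brownian motion \<open>M\<close> the
  integral below converges absolutely for all \<open>t\<close>, almost surely.\<close>

definition mmfOU :: "real \<Rightarrow> (real \<Rightarrow> 'a \<Rightarrow> real) \<Rightarrow> real \<Rightarrow> 'a \<Rightarrow> real" where
  "mmfOU l M t \<omega> = M t \<omega> - l * (LINT s:{..t}|lborel. exp (- l * (t - s)) * M s \<omega>)"

text \<open>The supremum is taken in the extended reals, so that it is \<open>-\<infinity>\<close> if no exponent is
  admissible and \<open>\<infinity>\<close> if all are.\<close>

definition holder_index :: "real \<Rightarrow> (real \<Rightarrow> real) \<Rightarrow> ereal" where
  "holder_index T x =
     Sup (ereal ` {a. 0 < a \<and>
       bdd_above {\<bar>x t - x s\<bar> / \<bar>t - s\<bar> powr a |s t. s \<in> {0..T} \<and> t \<in> {0..T} \<and> s \<noteq> t}})"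

end

(* The variance of an increment of M over a lag d is the sum of the sigma_k^2 d^(2 H_k). It is at most
   a constant times d^(2 H_inf), which with Gaussian moments of high order and the
   Kolmogorov--Chentsov criterion gives every exponent below H_inf. It is at least
   sigma_k^2 d^(2 H_k) for each k, so the small ball probability P(|M_d - M_0| <= C d^a) is
   O(d^(a - H_k)) and tends to 0 when a > H_k, which excludes every exponent above H_inf. Both
   estimates are proved for the finite Gaussian sums and passed to the limit in probability.
   Finally, U - M is Lipschitz on [0, T], and adding a Lipschitz function does not change a
   Hoelder index below 1. *)

theory Submission
  imports Defs
begin

subsection \<open>H\<ouml>lder exponents\<close>

text \<open>\<open>M\<close> is not self-similar, and \<open>H_inf\<close> need not be attained by
  any \<open>H_k\<close>. Every \<open>a > H_inf\<close> nevertheless exceeds some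
  \<open>H_k\<close>, and by independence the other terms can only increase the variance of an
  increment, so that single term controls the small ball probability. A failure of the exponent
  \<open>a\<close> is already visible along the pairs \<open>0\<close>, \<open>T / 2^n\<close>. In
  the other direction, moments of order \<open>2p\<close> lose \<open>1 / (2p)\<close> in the
  exponent: they give all \<open>a < H_inf - 1 / (2p)\<close>, and Gaussian variables allow
  \<open>p\<close> to be arbitrarily large. The law of \<open>M\<close> itself is never identified.
  An event for an increment of \<open>M\<close> is compared with the same event for a partial sum at
  half or twice the threshold, which only changes constants.\<close>

definition holder_on :: "real \<Rightarrow> real set \<Rightarrow> (real \<Rightarrow> real) \<Rightarrow> bool" where
  "holder_on a S x \<longleftrightarrow> (\<exists>K. \<forall>s\<in>S. \<forall>t\<in>S. \<bar>x t - x s\<bar> \<le> K * \<bar>t - s\<bar> powr a)"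

lemma holder_onI:
  "(\<And>s t. s \<in> S \<Longrightarrow> t \<in> S \<Longrightarrow> \<bar>x t - x s\<bar> \<le> K * \<bar>t - s\<bar> powr a) \<Longrightarrow> holder_on a S x"
  unfolding holder_on_def by blast

lemma holder_onE:
  assumes "holder_on a S x"
  obtains K where "0 \<le> K" "\<And>s t. s \<in> S \<Longrightarrow> t \<in> S \<Longrightarrow> \<bar>x t - x s\<bar> \<le> K * \<bar>t - s\<bar> powr a"
proof -
  from assms obtain K where K: "\<And>s t. s \<in> S \<Longrightarrow> t \<in> S \<Longrightarrow> \<bar>x t - x s\<bar> \<le> K * \<bar>t - s\<bar> powr a"
    unfolding holder_on_def by blast
  have "\<bar>x t - x s\<bar> \<le> max K 0 * \<bar>t - s\<bar> powr a" if "s \<in> S" "t \<in> S" for s t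
    by (rule order_trans[OF K[OF that]]) (intro mult_right_mono, auto)
  then show thesis by (intro that[of "max K 0"]) auto
qed

text \<open>On a bounded interval the surplus factor \<open>\<bar>t - s\<bar> powr (b - a)\<close>
  is at most \<open>T powr (b - a)\<close>. Downward closedness of the admissible exponents later
  reduces almost sure statements about all exponents to countably many.\<close>

lemma holder_on_mono:
  assumes "holder_on b {0..T} x" "0 < T" "a \<le> b"
  shows "holder_on a {0..T} x"
proof -
  obtain K where K: "0 \<le> K" "\<And>s t. s \<in> {0..T} \<Longrightarrow> t \<in> {0..T} \<Longrightarrow> \<bar>x t - x s\<bar> \<le> K * \<bar>t - s\<bar> powr b"
    using assms(1) by (rule holder_onE) blast
  show ?thesis
  proof (rule holder_onI[where K = "K * T powr (b - a)"])
    fix s t assume st: "s \<in> {0..T}" "t \<in> {0..T}"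
    have "\<bar>t - s\<bar> powr b = \<bar>t - s\<bar> powr (b - a) * \<bar>t - s\<bar> powr a"
      by (simp add: powr_add[symmetric])
    also have "\<dots> \<le> T powr (b - a) * \<bar>t - s\<bar> powr a"
      using st assms by (intro mult_right_mono powr_mono2) auto
    finally have "\<bar>t - s\<bar> powr b \<le> T powr (b - a) * \<bar>t - s\<bar> powr a" .
    then have "K * \<bar>t - s\<bar> powr b \<le> K * (T powr (b - a) * \<bar>t - s\<bar> powr a)"
      using K(1) by (rule mult_left_mono)
    then show "\<bar>x t - x s\<bar> \<le> K * T powr (b - a) * \<bar>t - s\<bar> powr a"
      using K(2)[OF st] by (simp add: mult.assoc)
  qed
qed

lemma holder_on_add:
  assumes "holder_on a S x" "holder_on a S y"
  shows "holder_on a S (\<lambda>t. x t + y t)"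
proof -
  obtain K where K: "\<And>s t. s \<in> S \<Longrightarrow> t \<in> S \<Longrightarrow> \<bar>x t - x s\<bar> \<le> K * \<bar>t - s\<bar> powr a"
    using assms(1) by (rule holder_onE) blast
  obtain L where L: "\<And>s t. s \<in> S \<Longrightarrow> t \<in> S \<Longrightarrow> \<bar>y t - y s\<bar> \<le> L * \<bar>t - s\<bar> powr a"
    using assms(2) by (rule holder_onE) blast
  show ?thesis
  proof (rule holder_onI[where K = "K + L"])
    fix s t assume st: "s \<in> S" "t \<in> S"
    show "\<bar>x t + y t - (x s + y s)\<bar> \<le> (K + L) * \<bar>t - s\<bar> powr a"
      using K[OF st] L[OF st] by (simp add: distrib_right)
  qed
qed

lemma holder_on_minus: "holder_on a S (\<lambda>t. - x t) \<longleftrightarrow> holder_on a S x"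
proof -
  have "\<bar>x s - x t\<bar> = \<bar>x t - x s\<bar>" for s t by simp
  then show ?thesis unfolding holder_on_def by simp
qed

text \<open>Clearing the denominator turns boundedness of the quotients into
  \<open>holder_on\<close>; the diagonal adds no condition since \<open>0 powr a = 0\<close>. The
  exponent \<open>h\<close> itself may or may not be admissible, as the supremum is the
  same.\<close>

lemma holder_index_eqI:
  assumes "0 < h"
    and below: "\<And>a. 0 < a \<Longrightarrow> a < h \<Longrightarrow> holder_on a {0..T} x"
    and above: "\<And>a. h < a \<Longrightarrow> \<not> holder_on a {0..T} x"
  shows "holder_index T x = ereal h"
proof -
  have iff: "bdd_above {\<bar>x t - x s\<bar> / \<bar>t - s\<bar> powr a |s t. s \<in> {0..T} \<and> t \<in> {0..T} \<and> s \<noteq> t} \<longleftrightarrow>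
      holder_on a {0..T} x" (is "bdd_above ?A \<longleftrightarrow> _") for a
  proof
    assume "bdd_above ?A"
    then obtain K where K: "\<And>z. z \<in> ?A \<Longrightarrow> z \<le> K" unfolding bdd_above_def by blast
    show "holder_on a {0..T} x"
    proof (rule holder_onI)
      fix s t assume st: "s \<in> {0..T}" "t \<in> {0..T}"
      show "\<bar>x t - x s\<bar> \<le> K * \<bar>t - s\<bar> powr a"
      proof (cases "s = t")
        case False
        then have "\<bar>x t - x s\<bar> / \<bar>t - s\<bar> powr a \<le> K" using st by (intro K) blast
        then show ?thesis using False by (simp add: divide_simps split: if_splits)
      qed simp
    qed
  next
    assume "holder_on a {0..T} x"
    then obtain K where K: "\<And>s t. s \<in> {0..T} \<Longrightarrow> t \<in> {0..T} \<Longrightarrow> \<bar>x t - x s\<bar> \<le> K * \<bar>t - s\<bar> powr a"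
      by (rule holder_onE) blast
    show "bdd_above ?A"
    proof (rule bdd_aboveI[where M = K])
      fix z assume "z \<in> ?A"
      then obtain s t where st: "s \<in> {0..T}" "t \<in> {0..T}" "s \<noteq> t"
        and z: "z = \<bar>x t - x s\<bar> / \<bar>t - s\<bar> powr a" by blast
      show "z \<le> K" using K[OF st(1,2)] st(3) by (simp add: z divide_simps)
    qed
  qed
  have "Sup (ereal ` {a. 0 < a \<and> holder_on a {0..T} x}) = ereal h"
  proof (rule Sup_eqI)
    fix z assume "z \<in> ereal ` {a. 0 < a \<and> holder_on a {0..T} x}"
    then show "z \<le> ereal h" using above by (force simp: not_less[symmetric])
  next
    fix y assume y: "\<And>z. z \<in> ereal ` {a. 0 < a \<and> holder_on a {0..T} x} \<Longrightarrow> z \<le> y"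
    show "ereal h \<le> y"
    proof (rule dense_le)
      fix z assume z: "z < ereal h"
      \<comment> \<open>The maximum with 0 keeps \<open>r\<close> a positive exponent even when
        \<open>z\<close> is negative or minus infinity.\<close>
      obtain r where r: "max 0 z < ereal r" "ereal r < ereal h"
        using ereal_dense2[of "max 0 z" "ereal h"] z assms(1) by (auto simp: zero_ereal_def)
      then have "0 < r" "r < h" by (auto simp: zero_ereal_def)
      then have "ereal r \<le> y" using below by (intro y) blast
      moreover have "z \<le> ereal r" using r by (auto intro: less_imp_le)
      ultimately show "z \<le> y" by (rule order_trans[rotated])
    qed
  qed
  then show ?thesis unfolding holder_index_def iff .
qed

lemma lipschitz_imp_holder_on:
  assumes "L-lipschitz_on S x"
  shows "holder_on 1 S x"
  using lipschitz_onD[OF assms] by (intro holder_onI[where K = L]) (auto simp: dist_real_def)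

text \<open>If the sum had an exponent \<open>a > h\<close>, subtracting \<open>y\<close> would give
  \<open>x\<close> the exponent \<open>min a 1\<close>. The cap is there because \<open>y\<close> is
  only known to have exponents up to 1; \<open>min a 1\<close> still exceeds \<open>h\<close>
  because \<open>h < 1\<close>.\<close>

lemma holder_index_add_lipschitz:
  assumes "0 < T" "0 < h" "h < 1"
    and below: "\<And>a. 0 < a \<Longrightarrow> a < h \<Longrightarrow> holder_on a {0..T} x"
    and above: "\<And>a. h < a \<Longrightarrow> \<not> holder_on a {0..T} x"
    and lip: "L-lipschitz_on {0..T} y"
  shows "holder_index T (\<lambda>t. x t + y t) = ereal h"
proof (rule holder_index_eqI)
  have y: "holder_on a {0..T} y" if "a \<le> 1" for a
    using lipschitz_imp_holder_on[OF lip] assms(1) that by (rule holder_on_mono)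
  show "holder_on a {0..T} (\<lambda>t. x t + y t)" if "0 < a" "a < h" for a
    using below[OF that] y[of a] that assms by (intro holder_on_add) auto
  show "\<not> holder_on a {0..T} (\<lambda>t. x t + y t)" if "h < a" for a
  proof
    assume "holder_on a {0..T} (\<lambda>t. x t + y t)"
    then have "holder_on (min a 1) {0..T} (\<lambda>t. x t + y t)"
      using assms(1) by (rule holder_on_mono) simp
    moreover have "holder_on (min a 1) {0..T} (\<lambda>t. - y t)"
      unfolding holder_on_minus by (rule y) simp
    ultimately have "holder_on (min a 1) {0..T} (\<lambda>t. x t + y t + - y t)"
      by (rule holder_on_add)
    then show False using above[of "min a 1"] that assms(3) by simp
  qed
qed (fact assms)

subsection \<open>Kolmogorov--Chentsov criterion\<close>

lemma dyadic_floor_Suc: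
  fixes s :: real
  shows "\<lfloor>2 ^ Suc n * s\<rfloor> = 2 * \<lfloor>2 ^ n * s\<rfloor> \<or> \<lfloor>2 ^ Suc n * s\<rfloor> = 2 * \<lfloor>2 ^ n * s\<rfloor> + 1"
proof -
  have "2 ^ Suc n * s = 2 * (2 ^ n * s)" by simp
  then show ?thesis by linarith
qed

text \<open>Chaining along the dyadic floors \<open>\<lfloor>2\<^sup>n s\<rfloor> / 2\<^sup>n\<close>, which increase to \<open>s\<close> in steps of size
  \<open>0\<close> or \<open>2\<^sup>-\<^sup>n\<close>.\<close>

lemma dyadic_increments_imp_holder_on:
  fixes f :: "real \<Rightarrow> real"
  assumes cont: "continuous_on {0..1} f" and a: "0 < a" and K: "0 \<le> K"
    and incr: "\<And>n i. i < 2 ^ n \<Longrightarrow>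
      \<bar>f (real (Suc i) / 2 ^ n) - f (real i / 2 ^ n)\<bar> \<le> K * (2 powr - a) ^ n"
  shows "holder_on a {0..1} f"
proof -
  define r where "r = (2::real) powr - a"
  have r: "0 < r" "r < 1" using a by (auto simp: r_def powr_less_one)
  define d where "d n s = real_of_int \<lfloor>2 ^ n * s\<rfloor> / 2 ^ n" for n and s :: real
  have step: "\<bar>f (real_of_int (i + 1) / 2 ^ n) - f (real_of_int i / 2 ^ n)\<bar> \<le> K * r ^ n"
    if "0 \<le> i" "i < 2 ^ n" for i :: int and n
  proof -
    have "nat i < 2 ^ n" using that by (metis nat_less_iff of_nat_numeral of_nat_power)
    from incr[OF this] that(1) show ?thesis by (simp add: r_def add.commute)
  qed
  \<comment> \<open>The case \<open>j = i\<close> is included because a dyadic floor may stay put,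
    and \<open>j = 2 ^ n\<close> because the floor of \<open>s = 1\<close> is the right end
    point.\<close>
  have close: "\<bar>f (real_of_int j / 2 ^ n) - f (real_of_int i / 2 ^ n)\<bar> \<le> K * r ^ n"
    if "0 \<le> i" "j = i \<or> j = i + 1" "j \<le> 2 ^ n" for i j :: int and n
    using step[of i n] that K r by auto
  have bnd: "0 \<le> \<lfloor>2 ^ n * s\<rfloor>" "\<lfloor>2 ^ n * s\<rfloor> \<le> 2 ^ n" if "s \<in> {0..1}" for n and s :: real
  proof -
    show "0 \<le> \<lfloor>2 ^ n * s\<rfloor>" using that by simp
    have "2 ^ n * s \<le> 2 ^ n" using that by simp
    then have "2 ^ n * s < 2 ^ n + 1" by (rule le_less_trans) simp
    then show "\<lfloor>2 ^ n * s\<rfloor> \<le> 2 ^ n" by (simp add: floor_le_iff)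
  qed
  have refine: "\<bar>f (d (Suc n) s) - f (d n s)\<bar> \<le> K * r ^ Suc n" if s: "s \<in> {0..1}" for n s
  proof -
    \<comment> \<open>Written on the finer grid, the coarse floor has an even numerator, so both
      floors are equal or adjacent there.\<close>
    have "d n s = real_of_int (2 * \<lfloor>2 ^ n * s\<rfloor>) / 2 ^ Suc n" by (simp add: d_def)
    then show ?thesis
      using close[of "2 * \<lfloor>2 ^ n * s\<rfloor>" "\<lfloor>2 ^ Suc n * s\<rfloor>" "Suc n"]
        bnd[OF s, of n] bnd[OF s, of "Suc n"] dyadic_floor_Suc[of n s]
      by (simp only: d_def)
  qed
  have chain: "\<bar>f (d (n + m) s) - f (d n s)\<bar> \<le> K * r ^ n * (\<Sum>j<m. r ^ Suc j)"
    if s: "s \<in> {0..1}" for n m s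
  proof (induction m)
    case (Suc m)
    have "K * r ^ n * (\<Sum>j<Suc m. r ^ Suc j) =
        K * r ^ n * (\<Sum>j<m. r ^ Suc j) + K * r ^ Suc (n + m)"
      by (simp add: algebra_simps power_add)
    then show ?case using Suc refine[OF s, of "n + m"] by simp
  qed simp
  have geom: "(\<Sum>j<m. r ^ Suc j) \<le> r / (1 - r)" for m
  proof -
    have "(\<Sum>j<m. r ^ Suc j) \<le> (\<Sum>j. r ^ Suc j)"
      using r by (intro sum_le_suminf) (auto simp: summable_mult summable_geometric)
    also have "\<dots> = r / (1 - r)"
      using r suminf_geometric[of r] by (simp add: suminf_mult summable_geometric)
    finally show ?thesis .
  qed
  have dlim: "(\<lambda>n. d n s) \<longlonglongrightarrow> s" for s
  proof -
    have e: "\<bar>d n s - s\<bar> \<le> (1/2) ^ n" for n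
    proof -
      have "\<bar>d n s - s\<bar> = \<bar>real_of_int \<lfloor>2 ^ n * s\<rfloor> - 2 ^ n * s\<bar> / 2 ^ n"
        by (simp add: d_def diff_divide_distrib[symmetric] abs_divide field_simps)
      also have "\<dots> \<le> 1 / 2 ^ n" by (intro divide_right_mono) (auto, linarith)
      finally show ?thesis by (simp add: power_divide)
    qed
    have "(\<lambda>n. (1/2 :: real) ^ n) \<longlonglongrightarrow> 0" by (rule LIMSEQ_realpow_zero) auto
    then have "(\<lambda>n. d n s - s) \<longlonglongrightarrow> 0"
      by (rule Lim_null_comparison[rotated]) (use e in auto)
    then show ?thesis by (simp add: LIM_zero_iff)
  qed
  have dmem: "d n s \<in> {0..1}" if "s \<in> {0..1}" for n s
    using bnd[OF that, of n] by (simp add: d_def divide_le_eq)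
  have tail: "\<bar>f s - f (d n s)\<bar> \<le> K * r ^ n * (r / (1 - r))" if s: "s \<in> {0..1}" for n s
  proof (rule LIMSEQ_le_const2)
    have "(\<lambda>m. f (d (n + m) s)) \<longlonglongrightarrow> f s"
      using LIMSEQ_ignore_initial_segment[OF dlim[of s], of n] s dmem[OF s]
      by (intro continuous_on_tendsto_compose[OF cont]) (auto simp: add.commute)
    then show "(\<lambda>m. \<bar>f (d (n + m) s) - f (d n s)\<bar>) \<longlonglongrightarrow> \<bar>f s - f (d n s)\<bar>"
      by (intro tendsto_intros)
    have "\<bar>f (d (n + m) s) - f (d n s)\<bar> \<le> K * r ^ n * (r / (1 - r))" for m
      using chain[OF s, of n m] geom[of m] K r
      by (meson mult_left_mono mult_nonneg_nonneg order_trans zero_le_power less_imp_le)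
    then show "\<exists>N. \<forall>m\<ge>N. \<bar>f (d (n + m) s) - f (d n s)\<bar> \<le> K * r ^ n * (r / (1 - r))" by blast
  qed
  \<comment> \<open>Two geometric tails, from \<open>s\<close> and from \<open>t\<close> to their
    floors, and one step between the floors.\<close>
  define C where "C = K * (2 * (r / (1 - r)) + 1)"
  have C_split: "K * (2 * q + 1) * z = 2 * (K * z * q) + K * z" for q z :: real
    by (simp add: algebra_simps)
  have C: "0 \<le> C" using K r by (simp add: C_def)
  have less: "\<bar>f t - f s\<bar> \<le> C / r * \<bar>t - s\<bar> powr a" if st: "s \<in> {0..1}" "t \<in> {0..1}" "s < t" for s t
  proof -
    have "\<exists>n. (1/2::real) ^ n < t - s" using st by (intro real_arch_pow_inv) auto
    \<comment> \<open>The scale is the least such \<open>n\<close>. Level \<open>m = n - 1\<close>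
      is still at least as coarse as \<open>t - s\<close>, so the two floors there are equal or
      adjacent, while \<open>(1/2) ^ n < t - s\<close> turns \<open>r ^ n\<close> into
      \<open>\<bar>t - s\<bar> powr a\<close>. Passing from \<open>m\<close> to \<open>n\<close>
      costs the factor \<open>1 / r\<close>.\<close>
    then obtain n where n: "(1/2::real) ^ n < t - s" "\<And>m. m < n \<Longrightarrow> \<not> (1/2::real) ^ m < t - s"
      using exists_least_iff[of "\<lambda>n. (1/2::real) ^ n < t - s"] by blast
    from n(1) st have "n \<noteq> 0" by (intro notI) auto
    then obtain m where m: "n = Suc m" by (cases n) auto
    have le: "t - s \<le> (1/2) ^ m" using n(2)[of m] m by simp
    have "2 ^ m * t - 2 ^ m * s \<le> 1"
      using le by (simp add: right_diff_distrib[symmetric] power_divide field_simps)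
    moreover have "2 ^ m * s \<le> 2 ^ m * t" using st by simp
    ultimately have "\<lfloor>2 ^ m * t\<rfloor> = \<lfloor>2 ^ m * s\<rfloor> \<or> \<lfloor>2 ^ m * t\<rfloor> = \<lfloor>2 ^ m * s\<rfloor> + 1" by linarith
    then have "\<bar>f (d m t) - f (d m s)\<bar> \<le> K * r ^ m"
      unfolding d_def using bnd st by (intro close) auto
    then have "\<bar>f t - f s\<bar> \<le> C * r ^ m"
      using tail[OF st(1), of m] tail[OF st(2), of m] C_split[of "r / (1 - r)" "r ^ m"]
      unfolding C_def by linarith
    also have "r ^ m = r ^ n / r" using r m by simp
    also have "r ^ n = ((1/2) ^ n) powr a"
    proof -
      have "r ^ n = 2 powr (- a * real n)"
        by (simp add: r_def powr_realpow[symmetric] powr_powr)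
      also have "\<dots> = (2 powr - real n) powr a" by (simp add: powr_powr mult.commute)
      also have "2 powr - real n = (1/2::real) ^ n"
        by (simp add: powr_minus_divide powr_realpow power_one_over)
      finally show ?thesis .
    qed
    also have "C * (((1/2) ^ n) powr a / r) \<le> C * (\<bar>t - s\<bar> powr a / r)"
      using C r n(1) a by (intro mult_left_mono divide_right_mono powr_mono2) auto
    finally show ?thesis by simp
  qed
  show ?thesis
  proof (rule holder_onI[where K = "C / r"])
    fix s t :: real assume "s \<in> {0..1}" "t \<in> {0..1}"
    then show "\<bar>f t - f s\<bar> \<le> C / r * \<bar>t - s\<bar> powr a"
      using less[of s t] less[of t s]
      by (cases s t rule: linorder_cases) (auto simp: abs_minus_commute)
  qed
qed

text \<open>The usual moment bound is replaced by the tail bound that Markov's inequality derives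
  from it, since this form survives limits in probability. At level \<open>n\<close> there are
  \<open>2 ^ n\<close> increments, tested against the threshold \<open>2 powr (- a * n)\<close>; the
  union bound is geometric with ratio \<open>2 powr (1 + a * q - b) < 1\<close>, and Borel-Cantelli
  applies.\<close>

lemma (in prob_space) kolmogorov_chentsov_unit:
  fixes X :: "real \<Rightarrow> 'a \<Rightarrow> real"
  assumes meas [measurable]: "\<And>t. X t \<in> borel_measurable M"
    and cont: "\<And>\<omega>. \<omega> \<in> space M \<Longrightarrow> continuous_on {0..1} (\<lambda>t. X t \<omega>)"
    and tail: "\<And>s t e. s \<in> {0..1} \<Longrightarrow> t \<in> {0..1} \<Longrightarrow> s \<noteq> t \<Longrightarrow> 0 < e \<Longrightarrow>
      prob {\<omega> \<in> space M. e < \<bar>X t \<omega> - X s \<omega>\<bar>} \<le> C * \<bar>t - s\<bar> powr b / e powr q"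
    and a: "0 < a" "1 + a * q < b"
  shows "AE \<omega> in M. holder_on a {0..1} (\<lambda>t. X t \<omega>)"
proof -
  define r where "r = (2::real) powr - a"
  have r: "0 < r" by (simp add: r_def)
  define E where "E n i = {\<omega> \<in> space M. r ^ n < \<bar>X (real (Suc i) / 2 ^ n) \<omega> - X (real i / 2 ^ n) \<omega>\<bar>}"
    for n i :: nat
  have [measurable]: "E n i \<in> sets M" for n i unfolding E_def by measurable
  have E: "prob (E n i) \<le> C * (2 powr (a * q - b)) ^ n" if "i < 2 ^ n" for n i
  proof -
    have "real (Suc i) \<le> 2 ^ n" using that by (metis Suc_leI of_nat_le_iff of_nat_numeral of_nat_power)
    then have "prob (E n i) \<le> C * \<bar>real (Suc i) / 2 ^ n - real i / 2 ^ n\<bar> powr b / (r ^ n) powr q"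
      unfolding E_def using r that by (intro tail) (auto simp: divide_le_eq field_simps)
    also have "\<bar>real (Suc i) / 2 ^ n - real i / 2 ^ n\<bar> = 2 powr - real n"
      by (simp add: powr_minus powr_realpow divide_inverse algebra_simps)
    also have "(r ^ n) powr q = 2 powr (- a * real n * q)"
      by (simp add: r_def powr_realpow[symmetric] powr_powr)
    also have "C * (2 powr - real n) powr b / 2 powr (- a * real n * q) = C * (2 powr (a * q - b)) ^ n"
      by (simp add: powr_realpow[symmetric] powr_powr powr_diff[symmetric] times_divide_eq_right[symmetric]
          del: times_divide_eq_right) (simp add: algebra_simps)
    finally show ?thesis .
  qed
  define A where "A n = (\<Union>i<2 ^ n. E n i)" for n :: nat
  have [measurable]: "A n \<in> sets M" for n unfolding A_def by measurable
  have A: "prob (A n) \<le> C * (2 powr (1 + a * q - b)) ^ n" for n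
  proof -
    have "prob (A n) \<le> (\<Sum>i<2 ^ n. prob (E n i))"
      unfolding A_def by (intro finite_measure_subadditive_finite) auto
    also have "\<dots> \<le> (\<Sum>i<2 ^ n :: nat. C * (2 powr (a * q - b)) ^ n)"
      by (intro sum_mono E) simp
    also have "\<dots> = C * (2 * 2 powr (a * q - b)) ^ n" by (simp add: power_mult_distrib)
    also have "2 * 2 powr (a * q - b) = (2::real) powr (1 + a * q - b)"
      by (simp add: powr_add powr_diff)
    finally show ?thesis .
  qed
  have "AE \<omega> in M. eventually (\<lambda>n. \<omega> \<in> space M - A n) sequentially"
  proof (rule borel_cantelli_AE1)
    show "summable (\<lambda>n. prob (A n))"
    proof (rule summable_comparison_test')
      show "norm (prob (A n)) \<le> C * (2 powr (1 + a * q - b)) ^ n" for n using A by simp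
      show "summable (\<lambda>n. C * (2 powr (1 + a * q - b)) ^ n)"
        using a by (intro summable_mult summable_geometric) (simp add: powr_less_one)
    qed
  qed (auto simp: less_top[symmetric])
  then show ?thesis
  proof eventually_elim
    case (elim \<omega>)
    then obtain N where N: "\<And>n. N \<le> n \<Longrightarrow> \<omega> \<in> space M - A n"
      unfolding eventually_sequentially by blast
    have \<omega>: "\<omega> \<in> space M" using N[of N] by simp
    define D where "D n i = \<bar>X (real (Suc i) / 2 ^ n) \<omega> - X (real i / 2 ^ n) \<omega>\<bar>" for n i :: nat
    \<comment> \<open>The 1 serves the levels from \<open>N\<close> on; the sum dominates each of
      the finitely many normalized increments below \<open>N\<close>.\<close>
    define K where "K = 1 + (\<Sum>n<N. \<Sum>i<2 ^ n. D n i / r ^ n)"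
    have D0: "0 \<le> D n i / r ^ n" for n i using r by (simp add: D_def)
    have K: "1 \<le> K" unfolding K_def using D0 by (simp add: sum_nonneg)
    show ?case
    proof (rule dyadic_increments_imp_holder_on)
      show "\<bar>X (real (Suc i) / 2 ^ n) \<omega> - X (real i / 2 ^ n) \<omega>\<bar> \<le> K * (2 powr - a) ^ n"
        if i: "i < 2 ^ n" for n i
      proof (cases "n < N")
        case True
        have "D n i / r ^ n \<le> (\<Sum>i<2 ^ n. D n i / r ^ n)"
          using i D0 by (intro member_le_sum) auto
        also have "\<dots> \<le> (\<Sum>n<N. \<Sum>i<2 ^ n. D n i / r ^ n)"
          using True D0 by (intro member_le_sum sum_nonneg) auto
        also have "\<dots> \<le> K" by (simp add: K_def)
        finally show ?thesis using r by (simp add: divide_le_eq D_def r_def)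
      next
        case False
        then have "\<omega> \<notin> E n i" using N[of n] i unfolding A_def by auto
        then have "D n i \<le> r ^ n" using \<omega> by (simp add: E_def D_def)
        also have "\<dots> \<le> K * r ^ n" using K r by simp
        finally show ?thesis by (simp add: D_def r_def)
      qed
    qed (use cont \<omega> a K in auto)
  qed
qed

subsection \<open>Gaussian estimates and their limits\<close>

text \<open>Markov's inequality for the power \<open>2 * p\<close>; the constant is the even moment
  \<open>(2p-1)!!\<close> of the standard normal law.\<close>

lemma (in prob_space) normal_abs_tail_le:
  assumes \<sigma>: "0 < \<sigma>" and D: "distributed M lborel X (normal_density 0 \<sigma>)" and e: "0 < e"
  shows "prob {\<omega> \<in> space M. e < \<bar>X \<omega>\<bar>} \<le> fact (2 * p) / (2 ^ p * fact p) * (\<sigma> / e) ^ (2 * p)"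
proof -
  have [measurable]: "X \<in> borel_measurable M" using D by (simp add: distributed_def)
  have int: "integrable M (\<lambda>\<omega>. X \<omega> ^ (2 * p))"
    using integrable_normal_moment[OF \<sigma>, of 0 "2 * p"]
      distributed_integrable[OF D, of "\<lambda>x. x ^ (2 * p)"] by simp
  have E: "expectation (\<lambda>\<omega>. X \<omega> ^ (2 * p)) = fact (2 * p) / (2 ^ p * fact p) * \<sigma> ^ (2 * p)"
    using integral_normal_moment_even[OF \<sigma>, of 0 p]
      distributed_integral[OF D, of "\<lambda>x. x ^ (2 * p)"]
    by (simp add: power_divide power_mult)
  have "prob {\<omega> \<in> space M. e < \<bar>X \<omega>\<bar>} \<le> prob {\<omega> \<in> space M. e ^ (2 * p) \<le> X \<omega> ^ (2 * p)}"
  proof (intro finite_measure_mono)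
    have "e ^ (2 * p) \<le> x ^ (2 * p)" if "e < \<bar>x\<bar>" for x
      using power_mono[of e "\<bar>x\<bar>" "2 * p"] that e by (simp add: power_even_abs)
    then show "{\<omega> \<in> space M. e < \<bar>X \<omega>\<bar>} \<subseteq> {\<omega> \<in> space M. e ^ (2 * p) \<le> X \<omega> ^ (2 * p)}" by blast
  qed measurable
  also have "\<dots> \<le> expectation (\<lambda>\<omega>. X \<omega> ^ (2 * p)) / e ^ (2 * p)"
    using e by (intro integral_Markov_inequality_measure[OF int, of "{}"]) auto
  finally show ?thesis by (simp add: E power_divide)
qed

text \<open>The density is at most \<open>1 / (2 * \<sigma>)\<close>, as
  \<open>2 \<le> sqrt (2 * pi)\<close>, and the interval has length \<open>2 * e\<close>.\<close>

lemma (in prob_space) normal_small_ball_le: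
  assumes \<sigma>: "0 < \<sigma>" and D: "distributed M lborel X (normal_density 0 \<sigma>)" and e: "0 \<le> e"
  shows "prob {\<omega> \<in> space M. \<bar>X \<omega>\<bar> \<le> e} \<le> e / \<sigma>"
proof -
  have dens: "normal_density 0 \<sigma> x \<le> 1 / (2 * \<sigma>)" for x
  proof -
    have "2 * \<sigma> \<le> sqrt (2 * pi * \<sigma>\<^sup>2)"
      using pi_ge_two \<sigma> by (intro real_le_rsqrt) (simp add: power_mult_distrib)
    then have "1 / sqrt (2 * pi * \<sigma>\<^sup>2) \<le> 1 / (2 * \<sigma>)" using \<sigma> by (intro divide_left_mono) auto
    moreover have "exp (- (x - 0)\<^sup>2 / (2 * \<sigma>\<^sup>2)) \<le> 1" by simp
    ultimately have "1 / sqrt (2 * pi * \<sigma>\<^sup>2) * exp (- (x - 0)\<^sup>2 / (2 * \<sigma>\<^sup>2)) \<le> 1 / (2 * \<sigma>) * 1"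
      using \<sigma> by (intro mult_mono) auto
    then show ?thesis by (simp add: normal_density_def)
  qed
  have "emeasure M {\<omega> \<in> space M. \<bar>X \<omega>\<bar> \<le> e} = emeasure M (X -` {-e..e} \<inter> space M)"
    by (intro arg_cong[where f = "emeasure M"]) auto
  also have "\<dots> = (\<integral>\<^sup>+x. ennreal (normal_density 0 \<sigma> x) * indicator {-e..e} x \<partial>lborel)"
    by (rule distributed_emeasure[OF D]) simp
  also have "\<dots> \<le> (\<integral>\<^sup>+x. ennreal (1 / (2 * \<sigma>)) * indicator {-e..e} x \<partial>lborel)"
    using dens by (intro nn_integral_mono mult_right_mono) (auto intro: ennreal_leI)
  also have "\<dots> = ennreal (e / \<sigma>)"
    using e \<sigma> by (simp add: nn_integral_cmult ennreal_mult'[symmetric])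
  finally show ?thesis using e \<sigma> by (simp add: emeasure_eq_measure)
qed

text \<open>Chebyshev's inequality, carried out in \<open>ennreal\<close> because the integrals may
  be infinite for some \<open>n\<close>.\<close>

lemma (in prob_space) L2_limit_imp_tendsto_prob:
  fixes X :: "'a \<Rightarrow> real"
  assumes [measurable]: "X \<in> borel_measurable M" "\<And>n. Y n \<in> borel_measurable M"
    and lim: "(\<lambda>n. \<integral>\<^sup>+ \<omega>. ennreal ((X \<omega> - Y n \<omega>)\<^sup>2) \<partial>M) \<longlonglongrightarrow> 0" and e: "0 < e"
  shows "(\<lambda>n. prob {\<omega> \<in> space M. e \<le> \<bar>X \<omega> - Y n \<omega>\<bar>}) \<longlonglongrightarrow> 0"
proof -
  define I where "I n = (\<integral>\<^sup>+ \<omega>. ennreal ((X \<omega> - Y n \<omega>)\<^sup>2) \<partial>M)" for n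
  have le: "ennreal (prob {\<omega> \<in> space M. e \<le> \<bar>X \<omega> - Y n \<omega>\<bar>}) \<le> ennreal (1 / e\<^sup>2) * I n" for n
  proof -
    have "e \<le> \<bar>x\<bar> \<longleftrightarrow> 1 \<le> ennreal (1 / e\<^sup>2) * ennreal (x\<^sup>2)" for x
    proof -
      have "e \<le> \<bar>x\<bar> \<longleftrightarrow> e\<^sup>2 \<le> x\<^sup>2" using e by (simp add: abs_le_square_iff[symmetric])
      also have "\<dots> \<longleftrightarrow> 1 \<le> ennreal (1 / e\<^sup>2 * x\<^sup>2)" using e by (simp add: le_divide_eq)
      finally show ?thesis by (simp add: ennreal_mult'[symmetric])
    qed
    then have "ennreal (prob {\<omega> \<in> space M. e \<le> \<bar>X \<omega> - Y n \<omega>\<bar>}) =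
        emeasure M {\<omega> \<in> space M. 1 \<le> ennreal (1 / e\<^sup>2) * ennreal ((X \<omega> - Y n \<omega>)\<^sup>2)}"
      by (simp add: emeasure_eq_measure)
    also have "\<dots> \<le> ennreal (1 / e\<^sup>2) * (\<integral>\<^sup>+ \<omega>. ennreal ((X \<omega> - Y n \<omega>)\<^sup>2) * indicator (space M) \<omega> \<partial>M)"
      by (rule nn_integral_Markov_inequality) auto
    also have "(\<integral>\<^sup>+ \<omega>. ennreal ((X \<omega> - Y n \<omega>)\<^sup>2) * indicator (space M) \<omega> \<partial>M) = I n"
      unfolding I_def by (intro nn_integral_cong) auto
    finally show ?thesis .
  qed
  have "(\<lambda>n. ennreal (1 / e\<^sup>2) * I n) \<longlonglongrightarrow> ennreal (1 / e\<^sup>2) * 0"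
    using lim unfolding I_def by (intro ennreal_tendsto_cmult) auto
  then have "(\<lambda>n. ennreal (1 / e\<^sup>2) * I n) \<longlonglongrightarrow> ennreal 0" by simp
  then have "(\<lambda>n. ennreal (prob {\<omega> \<in> space M. e \<le> \<bar>X \<omega> - Y n \<omega>\<bar>})) \<longlonglongrightarrow> ennreal 0"
    by (rule tendsto_sandwich[OF _ _ tendsto_const, rotated 2])
      (simp, intro always_eventually allI le)
  then show ?thesis by (rule tendsto_ennrealD) auto
qed

text \<open>\<open>A n\<close> is the event \<open>S\<close> relaxed by the margin \<open>e\<close>:
  \<open>S\<close> is covered by \<open>A n\<close> and the event of an error of at least
  \<open>e\<close>, whose probability vanishes. Bounds uniform in large \<open>n\<close> thus reach
  the limit.\<close>

lemma (in prob_space) prob_le_of_L2_limit: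
  fixes X :: "'a \<Rightarrow> real"
  assumes [measurable]: "X \<in> borel_measurable M" "\<And>n. Y n \<in> borel_measurable M"
    and lim: "(\<lambda>n. \<integral>\<^sup>+ \<omega>. ennreal ((X \<omega> - Y n \<omega>)\<^sup>2) \<partial>M) \<longlonglongrightarrow> 0" and e: "0 < e"
    and [measurable]: "\<And>n. A n \<in> events"
    and sub: "\<And>n \<omega>. \<omega> \<in> S \<Longrightarrow> \<omega> \<in> space M \<Longrightarrow> \<bar>X \<omega> - Y n \<omega>\<bar> < e \<Longrightarrow> \<omega> \<in> A n"
    and S: "S \<subseteq> space M"
    and \<beta>: "\<And>n. N \<le> n \<Longrightarrow> prob (A n) \<le> \<beta>"
  shows "prob S \<le> \<beta>"
proof -
  define p where "p n = prob {\<omega> \<in> space M. e \<le> \<bar>X \<omega> - Y n \<omega>\<bar>}" for n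
  have "(\<lambda>n. p n + \<beta>) \<longlonglongrightarrow> 0 + \<beta>"
    unfolding p_def by (intro tendsto_intros L2_limit_imp_tendsto_prob lim e) auto
  moreover have "prob S \<le> p n + \<beta>" if "N \<le> n" for n
  proof -
    have "prob S \<le> prob ({\<omega> \<in> space M. e \<le> \<bar>X \<omega> - Y n \<omega>\<bar>} \<union> A n)"
      using sub[of _ n] S by (intro finite_measure_mono) (auto simp: not_less[symmetric])
    also have "\<dots> \<le> p n + prob (A n)" unfolding p_def by (rule measure_Un_le) auto
    finally show ?thesis using \<beta>[OF that] by simp
  qed
  ultimately show ?thesis by (intro LIMSEQ_le_const[of _ \<beta>]) auto
qed

text \<open>The means and covariances in \<open>fBm\<close> are Bochner integrals, which can be
  combined linearly only once integrability is known. The nondegenerate case expands the square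
  around the mean \<open>\<mu>\<close>.\<close>

lemma (in prob_space) gaussian_rv_square_integrable:
  assumes "gaussian_rv M X"
  shows "integrable M (\<lambda>\<omega>. (X \<omega>)\<^sup>2)" "integrable M X"
proof -
  have [measurable]: "X \<in> borel_measurable M" using assms by (simp add: gaussian_rv_def)
  show sq: "integrable M (\<lambda>\<omega>. (X \<omega>)\<^sup>2)"
    using assms unfolding gaussian_rv_def
  proof (elim conjE disjE exE)
    fix \<mu> s :: real assume s: "0 < s" and D: "distributed M lborel X (normal_density \<mu> s)"
    have "integrable lborel (\<lambda>x. normal_density \<mu> s x * (x - \<mu>)\<^sup>2 + 2 * \<mu> * (normal_density \<mu> s x * x)
        - \<mu>\<^sup>2 * normal_density \<mu> s x)"
      using integrable_normal_moment[OF s] integrable_normal_moment_nz_1[OF s] s by auto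
    also have "(\<lambda>x. normal_density \<mu> s x * (x - \<mu>)\<^sup>2 + 2 * \<mu> * (normal_density \<mu> s x * x)
        - \<mu>\<^sup>2 * normal_density \<mu> s x) = (\<lambda>x. normal_density \<mu> s x * x\<^sup>2)"
      by (simp add: fun_eq_iff power2_eq_square algebra_simps)
    finally show ?thesis using distributed_integrable[OF D, of "\<lambda>x. x\<^sup>2"] by simp
  next
    fix c assume "AE \<omega> in M. X \<omega> = c"
    then have "AE \<omega> in M. (X \<omega>)\<^sup>2 = c\<^sup>2" by auto
    then show ?thesis by (subst integrable_cong_AE[where g = "\<lambda>_. c\<^sup>2"]) auto
  qed
  show "integrable M X" by (rule square_integrable_imp_integrable[OF _ sq]) simp
qed

text \<open>The increment is a linear combination of two values, hence Gaussian, and the covariance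
  formula determines its mean and variance.\<close>

lemma (in prob_space) fBm_increment_distributed:
  assumes B: "fBm M h B" and st: "s \<noteq> t"
  shows "distributed M lborel (\<lambda>\<omega>. B t \<omega> - B s \<omega>) (normal_density 0 (\<bar>t - s\<bar> powr h))"
proof -
  have gp: "gaussian_rv M (\<lambda>\<omega>. \<Sum>t\<in>J. c t * B t \<omega>)" if "finite J" for J c
    using B that by (simp add: fBm_def gaussian_process_def)
  have mean: "expectation (B t) = 0" for t using B by (simp add: fBm_def)
  have cov: "expectation (\<lambda>\<omega>. B t \<omega> * B s \<omega>) =
      (\<bar>t\<bar> powr (2 * h) + \<bar>s\<bar> powr (2 * h) - \<bar>t - s\<bar> powr (2 * h)) / 2" for s t
    using B by (simp add: fBm_def)
  have g1: "gaussian_rv M (B t)" for t using gp[of "{t}" "\<lambda>_. 1"] by simp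
  have [measurable]: "B t \<in> borel_measurable M" for t using g1[of t] by (simp add: gaussian_rv_def)
  note i1 = gaussian_rv_square_integrable[OF g1]
  have i2: "integrable M (\<lambda>\<omega>. B t \<omega> * B s \<omega>)" for s t
  proof (rule Bochner_Integration.integrable_bound)
    show "integrable M (\<lambda>\<omega>. (B t \<omega>)\<^sup>2 + (B s \<omega>)\<^sup>2)" using i1(1) by simp
    have "\<bar>x * y\<bar> \<le> x\<^sup>2 + y\<^sup>2" for x y :: real
    proof -
      have "2 * (\<bar>x\<bar> * \<bar>y\<bar>) \<le> x\<^sup>2 + y\<^sup>2"
        using sum_squares_bound[of "\<bar>x\<bar>" "\<bar>y\<bar>"] by simp
      moreover have "0 \<le> \<bar>x\<bar> * \<bar>y\<bar>" by simp
      ultimately show ?thesis unfolding abs_mult by linarith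
    qed
    then show "AE \<omega> in M. norm (B t \<omega> * B s \<omega>) \<le> norm ((B t \<omega>)\<^sup>2 + (B s \<omega>)\<^sup>2)" by simp
  qed measurable
  define X where "X \<omega> = B t \<omega> - B s \<omega>" for \<omega>
  have [measurable]: "X \<in> borel_measurable M" unfolding X_def by measurable
  have EX: "expectation X = 0" unfolding X_def using i1 mean by simp
  have "expectation (\<lambda>\<omega>. (X \<omega>)\<^sup>2) =
      expectation (\<lambda>\<omega>. B t \<omega> * B t \<omega> + B s \<omega> * B s \<omega> - 2 * (B t \<omega> * B s \<omega>))"
    unfolding X_def by (intro Bochner_Integration.integral_cong) (auto simp: power2_eq_square algebra_simps)
  also have "\<dots> = \<bar>t - s\<bar> powr (2 * h)" using i2 by (simp add: cov) (simp add: field_simps)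
  also have "\<dots> = (\<bar>t - s\<bar> powr h)\<^sup>2" unfolding power2_eq_square mult_2 by (rule powr_add)
  finally have EX2: "expectation (\<lambda>\<omega>. (X \<omega>)\<^sup>2) = (\<bar>t - s\<bar> powr h)\<^sup>2" .
  have "gaussian_rv M X"
    using gp[of "{s, t}" "\<lambda>u. if u = t then 1 else -1"] st unfolding X_def by simp
  then have "(\<exists>\<mu> s. 0 < s \<and> distributed M lborel X (normal_density \<mu> s)) \<or> (\<exists>c. AE \<omega> in M. X \<omega> = c)"
    by (simp add: gaussian_rv_def)
  then show ?thesis
  proof (elim disjE exE conjE)
    fix \<mu> r :: real assume r: "0 < r" and D: "distributed M lborel X (normal_density \<mu> r)"
    have \<mu>: "\<mu> = 0" using normal_distributed_expectation[OF r D] EX by simp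
    have "r\<^sup>2 = (\<bar>t - s\<bar> powr h)\<^sup>2" using normal_distributed_variance[OF r D] EX EX2 by simp
    then have "r = \<bar>t - s\<bar> powr h" using r by (simp add: power2_eq_iff_nonneg)
    then show ?thesis using D \<mu> unfolding X_def by simp
  next
    \<comment> \<open>The degenerate case is contradictory: it would force variance 0, but
      \<open>s \<noteq> t\<close>.\<close>
    fix c assume c: "AE \<omega> in M. X \<omega> = c"
    then have "expectation X = expectation (\<lambda>_. c)" by (intro integral_cong_AE) auto
    then have "c = 0" using EX by (simp add: prob_space)
    then have "expectation (\<lambda>\<omega>. (X \<omega>)\<^sup>2) = expectation (\<lambda>_. 0)"
      using c by (intro integral_cong_AE) auto
    then show ?thesis using EX2 st by simp
  qed
qed

subsection \<open>Multi-mixed fractional Brownian motion\<close>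

text \<open>The process is called \<open>Z\<close> because \<open>M\<close> is the measure of
  \<open>prob_space\<close>.\<close>

locale mmfBm_process = prob_space +
  fixes \<sigma> H :: "nat \<Rightarrow> real" and B :: "nat \<Rightarrow> real \<Rightarrow> 'a \<Rightarrow> real" and Z :: "real \<Rightarrow> 'a \<Rightarrow> real"
  assumes mmfBm: "mmfBm M \<sigma> H B Z"
begin

abbreviation h :: real where "h \<equiv> INF k. H k"

definition partial_increment :: "nat \<Rightarrow> real \<Rightarrow> real \<Rightarrow> 'a \<Rightarrow> real" where
  "partial_increment n s t \<omega> = (\<Sum>k<n. \<sigma> k * (B k t \<omega> - B k s \<omega>))"

lemma \<sigma>_pos: "0 < \<sigma> k"
  and \<sigma>_summable: "summable (\<lambda>k. (\<sigma> k)\<^sup>2)"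
  and H_pos: "0 < H k"
  and H_less_1: "H k < 1"
  and h_pos: "0 < h"
  and fBm_B: "fBm M (H k) (B k)"
  and indep_B: "indep_vars (\<lambda>_. PiM UNIV (\<lambda>_. borel)) (\<lambda>k \<omega> t. B k t \<omega>) UNIV"
  and measurable_Z [measurable]: "Z t \<in> borel_measurable M"
  and Z_limit: "(\<lambda>n. \<integral>\<^sup>+ \<omega>. ennreal ((Z t \<omega> - (\<Sum>k<n. \<sigma> k * B k t \<omega>))\<^sup>2) \<partial>M) \<longlonglongrightarrow> 0"
  and continuous_Z: "\<omega> \<in> space M \<Longrightarrow> continuous_on S (\<lambda>t. Z t \<omega>)"
  using mmfBm unfolding mmfBm_def continuous_paths_def
  by (auto intro: continuous_on_subset)

lemma \<sigma>_nonzero [simp]: "\<sigma> k \<noteq> 0"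
  using \<sigma>_pos[of k] by simp

lemma bdd_below_H: "bdd_below (range H)"
  using H_pos by (intro bdd_belowI[where m = 0]) (auto intro: less_imp_le)

lemma h_le: "h \<le> H k"
  by (intro cINF_lower bdd_below_H) simp

lemma h_less_1: "h < 1"
  using h_le[of 0] H_less_1[of 0] by simp

lemma measurable_B [measurable]: "B k t \<in> borel_measurable M"
proof -
  have "gaussian_process M (B k)" using fBm_B[of k] by (simp add: fBm_def)
  from this[unfolded gaussian_process_def, rule_format, of "{t}" "\<lambda>_. 1"]
  show ?thesis by (simp add: gaussian_rv_def)
qed

lemma measurable_partial_increment [measurable]: "partial_increment n s t \<in> borel_measurable M"
  unfolding partial_increment_def by measurable

text \<open>Independence of whole paths passes to the scaled increments, which are measurable
  functions of two coordinates, so their variances add. The empty sum is excluded because it has no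
  density.\<close>

lemma partial_increment_distributed:
  assumes st: "s \<noteq> t" and n: "0 < n"
  shows "distributed M lborel (partial_increment n s t)
    (normal_density 0 (sqrt (\<Sum>k<n. (\<sigma> k * \<bar>t - s\<bar> powr H k)\<^sup>2)))"
proof -
  have "distributed M lborel (\<lambda>\<omega>. \<Sum>k<n. \<sigma> k * (B k t \<omega> - B k s \<omega>))
    (normal_density (\<Sum>k<n. 0) (sqrt (\<Sum>k<n. (\<sigma> k * \<bar>t - s\<bar> powr H k)\<^sup>2)))"
  proof (rule sum_indep_normal)
    show "indep_vars (\<lambda>i. borel) (\<lambda>k \<omega>. \<sigma> k * (B k t \<omega> - B k s \<omega>)) {..<n}"
      by (rule indep_vars_compose2[OF indep_vars_subset[OF indep_B subset_UNIV],
            where Y = "\<lambda>k f. \<sigma> k * (f t - f s)"]) measurable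
    show "distributed M lborel (\<lambda>\<omega>. \<sigma> k * (B k t \<omega> - B k s \<omega>))
        (normal_density 0 (\<sigma> k * \<bar>t - s\<bar> powr H k))" for k
      using normal_density_affine[OF fBm_increment_distributed[OF fBm_B[of k] st], of "\<sigma> k" 0]
        st \<sigma>_pos[of k] by simp
  qed (use st n \<sigma>_pos in auto)
  then show ?thesis unfolding partial_increment_def by simp
qed

lemma partial_increment_limit:
  "(\<lambda>n. \<integral>\<^sup>+ \<omega>. ennreal ((Z t \<omega> - Z s \<omega> - partial_increment n s t \<omega>)\<^sup>2) \<partial>M) \<longlonglongrightarrow> 0"
proof -
  define I where "I t n = (\<integral>\<^sup>+ \<omega>. ennreal ((Z t \<omega> - (\<Sum>k<n. \<sigma> k * B k t \<omega>))\<^sup>2) \<partial>M)" for t n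
  have bound: "(\<integral>\<^sup>+ \<omega>. ennreal ((Z t \<omega> - Z s \<omega> - partial_increment n s t \<omega>)\<^sup>2) \<partial>M) \<le>
      ennreal 2 * I t n + ennreal 2 * I s n" for n
  proof -
    define D where "D t \<omega> = Z t \<omega> - (\<Sum>k<n. \<sigma> k * B k t \<omega>)" for t \<omega>
    have [measurable]: "D t \<in> borel_measurable M" for t unfolding D_def by measurable
    have eq: "Z t \<omega> - Z s \<omega> - partial_increment n s t \<omega> = D t \<omega> - D s \<omega>" for \<omega>
      by (simp add: partial_increment_def D_def right_diff_distrib sum_subtractf)
    have sq: "(x - y)\<^sup>2 \<le> 2 * x\<^sup>2 + 2 * y\<^sup>2" for x y :: real
      using zero_le_power2[of "x + y"] by (simp add: power2_eq_square algebra_simps)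
    have sq': "ennreal ((x - y)\<^sup>2) \<le> ennreal 2 * ennreal (x\<^sup>2) + ennreal 2 * ennreal (y\<^sup>2)"
      for x y :: real
      using ennreal_leI[OF sq[of x y]] by (simp add: ennreal_mult)
    have "(\<integral>\<^sup>+ \<omega>. ennreal ((Z t \<omega> - Z s \<omega> - partial_increment n s t \<omega>)\<^sup>2) \<partial>M) \<le>
        (\<integral>\<^sup>+ \<omega>. ennreal 2 * ennreal ((D t \<omega>)\<^sup>2) + ennreal 2 * ennreal ((D s \<omega>)\<^sup>2) \<partial>M)"
      unfolding eq by (intro nn_integral_mono sq')
    also have "\<dots> = ennreal 2 * I t n + ennreal 2 * I s n"
      unfolding I_def D_def[symmetric] by (subst nn_integral_add) (simp_all add: nn_integral_cmult)
    finally show ?thesis .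
  qed
  have "(\<lambda>n. ennreal 2 * I t n + ennreal 2 * I s n) \<longlonglongrightarrow> ennreal 2 * 0 + ennreal 2 * 0"
    unfolding I_def by (intro tendsto_add ennreal_tendsto_cmult Z_limit) auto
  then have "(\<lambda>n. ennreal 2 * I t n + ennreal 2 * I s n) \<longlonglongrightarrow> 0" by simp
  then show ?thesis
    by (rule tendsto_sandwich[OF _ _ tendsto_const, rotated 2])
      (simp, intro always_eventually allI bound)
qed

text \<open>Half of \<open>e\<close> is spent on the approximation error and half on the Gaussian
  sum, hence the factor 2.\<close>

lemma increment_tail:
  assumes st: "s \<noteq> t" "\<bar>t - s\<bar> \<le> R" and R: "1 \<le> R" and e: "0 < e"
  shows "prob {\<omega> \<in> space M. e < \<bar>Z t \<omega> - Z s \<omega>\<bar>} \<le> fact (2 * p) / (2 ^ p * fact p) *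
    (2 * (R * sqrt (\<Sum>k. (\<sigma> k)\<^sup>2)) * \<bar>t - s\<bar> powr h / e) ^ (2 * p)"
proof (rule prob_le_of_L2_limit[OF _ _ partial_increment_limit[where s = s and t = t], where N = 1 and e = "e / 2"
    and A = "\<lambda>n. {\<omega> \<in> space M. e / 2 < \<bar>partial_increment n s t \<omega>\<bar>}"])
  fix n :: nat assume n: "1 \<le> n"
  define d where "d = \<bar>t - s\<bar>"
  have d: "0 < d" "d \<le> R" using st by (auto simp: d_def)
  define v where "v = sqrt (\<Sum>k<n. (\<sigma> k * d powr H k)\<^sup>2)"
  have v0: "0 < v" unfolding v_def using n d by (intro real_sqrt_gt_zero sum_pos) (auto simp: lessThan_empty_iff)
  \<comment> \<open>Since \<open>0 \<le> H k - h \<le> 1\<close>, the surplus power is at most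
    \<open>R\<close>, uniformly in \<open>k\<close> and also for lags above 1.\<close>
  have dH: "d powr H k \<le> R * d powr h" for k
  proof -
    have "d powr H k = d powr (H k - h) * d powr h" by (simp add: powr_add[symmetric])
    also have "d powr (H k - h) \<le> R powr (H k - h)"
      using d h_le[of k] by (intro powr_mono2) auto
    also have "\<dots> \<le> R powr 1" using R H_less_1[of k] h_pos by (intro powr_mono) auto
    finally show ?thesis using R by (simp add: mult_right_mono)
  qed
  have "(\<Sum>k<n. (\<sigma> k * d powr H k)\<^sup>2) \<le> (\<Sum>k<n. (\<sigma> k)\<^sup>2 * (R * d powr h)\<^sup>2)"
    using dH by (intro sum_mono) (auto simp: power_mult_distrib[of "\<sigma> _"] intro!: mult_left_mono power_mono)
  also have "\<dots> = (\<Sum>k<n. (\<sigma> k)\<^sup>2) * (R * d powr h)\<^sup>2" by (simp add: sum_distrib_right)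
  also have "\<dots> \<le> (\<Sum>k. (\<sigma> k)\<^sup>2) * (R * d powr h)\<^sup>2"
    by (intro mult_right_mono sum_le_suminf \<sigma>_summable) auto
  finally have "v \<le> sqrt ((\<Sum>k. (\<sigma> k)\<^sup>2) * (R * d powr h)\<^sup>2)" unfolding v_def by simp
  also have "\<dots> = R * sqrt (\<Sum>k. (\<sigma> k)\<^sup>2) * d powr h" using R by (simp add: real_sqrt_mult)
  finally have v: "v \<le> R * sqrt (\<Sum>k. (\<sigma> k)\<^sup>2) * d powr h" .
  have "distributed M lborel (partial_increment n s t) (normal_density 0 v)"
    unfolding v_def d_def using n by (intro partial_increment_distributed st) simp
  then have "prob {\<omega> \<in> space M. e / 2 < \<bar>partial_increment n s t \<omega>\<bar>} \<le>
      fact (2 * p) / (2 ^ p * fact p) * (v / (e / 2)) ^ (2 * p)"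
    using e v0 by (intro normal_abs_tail_le) auto
  also have "\<dots> \<le> fact (2 * p) / (2 ^ p * fact p) * (2 * (R * sqrt (\<Sum>k. (\<sigma> k)\<^sup>2)) * d powr h / e) ^ (2 * p)"
    using v v0 e by (intro mult_left_mono power_mono) (auto simp: divide_right_mono)
  finally show "prob {\<omega> \<in> space M. e / 2 < \<bar>partial_increment n s t \<omega>\<bar>} \<le>
      fact (2 * p) / (2 ^ p * fact p) *
      (2 * (R * sqrt (\<Sum>k. (\<sigma> k)\<^sup>2)) * \<bar>t - s\<bar> powr h / e) ^ (2 * p)"
    by (simp add: d_def)
qed (use e in \<open>auto simp: abs_if split: if_splits\<close>)

text \<open>From \<open>n = Suc k\<close> on the partial sum contains the term \<open>k\<close>, so
  its standard deviation is at least that of this term. The radius doubles to absorb the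
  approximation error.\<close>

lemma increment_small_ball:
  assumes st: "s \<noteq> t" and e: "0 < e"
  shows "prob {\<omega> \<in> space M. \<bar>Z t \<omega> - Z s \<omega>\<bar> \<le> e} \<le> 2 * e / (\<sigma> k * \<bar>t - s\<bar> powr H k)"
proof (rule prob_le_of_L2_limit[OF _ _ partial_increment_limit[where s = s and t = t], where N = "Suc k" and e = e
    and A = "\<lambda>n. {\<omega> \<in> space M. \<bar>partial_increment n s t \<omega>\<bar> \<le> 2 * e}"])
  fix n assume n: "Suc k \<le> n"
  define v where "v = sqrt (\<Sum>k<n. (\<sigma> k * \<bar>t - s\<bar> powr H k)\<^sup>2)"
  have "sqrt ((\<sigma> k * \<bar>t - s\<bar> powr H k)\<^sup>2) \<le> v"
    unfolding v_def using n by (intro real_sqrt_le_mono member_le_sum) auto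
  then have v: "\<sigma> k * \<bar>t - s\<bar> powr H k \<le> v" using \<sigma>_pos[of k] by (simp add: abs_mult)
  have pos: "0 < \<sigma> k * \<bar>t - s\<bar> powr H k" using \<sigma>_pos[of k] st by simp
  have "distributed M lborel (partial_increment n s t) (normal_density 0 v)"
    unfolding v_def using n by (intro partial_increment_distributed st) simp
  then have "prob {\<omega> \<in> space M. \<bar>partial_increment n s t \<omega>\<bar> \<le> 2 * e} \<le> 2 * e / v"
    using e v pos by (intro normal_small_ball_le) auto
  also have "\<dots> \<le> 2 * e / (\<sigma> k * \<bar>t - s\<bar> powr H k)"
    using e v pos by (intro divide_left_mono) auto
  finally show "prob {\<omega> \<in> space M. \<bar>partial_increment n s t \<omega>\<bar> \<le> 2 * e} \<le>
      2 * e / (\<sigma> k * \<bar>t - s\<bar> powr H k)" .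
qed (use e in \<open>auto simp: abs_if split: if_splits\<close>)

lemma AE_holder_on:
  assumes T: "0 < T" and a: "0 < a" "a < h"
  shows "AE \<omega> in M. holder_on a {0..T} (\<lambda>t. Z t \<omega>)"
proof -
  \<comment> \<open>This is the condition \<open>1 + a * q < b\<close> for \<open>q = 2 * p\<close>
    and \<open>b = 2 * p * h\<close>.\<close>
  obtain p :: nat where p: "1 / (2 * (h - a)) < real p" using reals_Archimedean2 by blast
  define R where "R = max 1 T"
  define V where "V = 2 * (R * sqrt (\<Sum>k. (\<sigma> k)\<^sup>2))"
  define C where "C = fact (2 * p) / (2 ^ p * fact p) * (V * T powr h) ^ (2 * p)"
  have "AE \<omega> in M. holder_on a {0..1} (\<lambda>u. Z (T * u) \<omega>)"
  proof (rule kolmogorov_chentsov_unit[where C = C and b = "2 * real p * h" and q = "2 * real p"])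
    show "continuous_on {0..1} (\<lambda>u. Z (T * u) \<omega>)" if "\<omega> \<in> space M" for \<omega>
      by (rule continuous_on_compose2[OF continuous_Z[OF that, of UNIV]]) (auto intro: continuous_intros)
    show "1 + a * (2 * real p) < 2 * real p * h"
      using p a by (simp add: divide_less_eq algebra_simps)
    fix s t e :: real assume st: "s \<in> {0..1}" "t \<in> {0..1}" "s \<noteq> t" and e: "0 < e"
    have eq: "\<bar>T * t - T * s\<bar> = T * \<bar>t - s\<bar>" using T by (simp add: abs_mult right_diff_distrib[symmetric])
    have "T * \<bar>t - s\<bar> \<le> T * 1" using st T by (intro mult_left_mono) auto
    then have "\<bar>T * t - T * s\<bar> \<le> R" unfolding eq R_def by simp
    then have "prob {\<omega> \<in> space M. e < \<bar>Z (T * t) \<omega> - Z (T * s) \<omega>\<bar>} \<le>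
        fact (2 * p) / (2 ^ p * fact p) * (V * (T * \<bar>t - s\<bar>) powr h / e) ^ (2 * p)"
      unfolding V_def eq[symmetric] using st T e
      by (intro increment_tail) (auto simp: R_def)
    also have "(V * (T * \<bar>t - s\<bar>) powr h / e) ^ (2 * p) =
        (V * T powr h) ^ (2 * p) * (\<bar>t - s\<bar> powr h) ^ (2 * p) / e ^ (2 * p)"
      using T by (simp add: powr_mult power_mult_distrib power_divide)
    also have "(\<bar>t - s\<bar> powr h) ^ (2 * p) = \<bar>t - s\<bar> powr (2 * real p * h)"
      using st(3) by (simp add: powr_realpow[symmetric] powr_powr mult.commute)
    also have "e ^ (2 * p) = e powr (2 * real p)" using e by (simp add: powr_realpow[symmetric])
    finally show "prob {\<omega> \<in> space M. e < \<bar>Z (T * t) \<omega> - Z (T * s) \<omega>\<bar>} \<le>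
        C * \<bar>t - s\<bar> powr (2 * real p * h) / e powr (2 * real p)"
      by (simp add: C_def)
  qed (use a in auto)
  then show ?thesis
  proof eventually_elim
    case (elim \<omega>)
    then obtain K where K: "\<And>s t. s \<in> {0..1} \<Longrightarrow> t \<in> {0..1} \<Longrightarrow>
        \<bar>Z (T * t) \<omega> - Z (T * s) \<omega>\<bar> \<le> K * \<bar>t - s\<bar> powr a"
      by (rule holder_onE) blast
    show ?case
    proof (rule holder_onI[where K = "K / T powr a"])
      fix s t assume st: "s \<in> {0..T}" "t \<in> {0..T}"
      have "\<bar>t / T - s / T\<bar> = \<bar>t - s\<bar> / T" using T by (simp add: diff_divide_distrib[symmetric])
      then show "\<bar>Z t \<omega> - Z s \<omega>\<bar> \<le> K / T powr a * \<bar>t - s\<bar> powr a"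
        using K[of "s / T" "t / T"] st T by (simp add: powr_divide)
    qed
  qed
qed

lemma AE_not_holder_on:
  assumes T: "0 < T" and a: "H k < a"
  shows "AE \<omega> in M. \<not> holder_on a {0..T} (\<lambda>t. Z t \<omega>)"
proof -
  define u where "u n = T / 2 ^ n" for n :: nat
  have u: "0 < u n" "u n \<le> T" for n using T by (auto simp: u_def divide_le_eq)
  \<comment> \<open>Integer constants make the exceptional set a countable union. Each
    \<open>E m\<close> is null, as its probability is bounded by the small ball estimate for every
    \<open>n\<close>, and these bounds tend to 0 because \<open>a > H k\<close>.\<close>
  define E where "E m = {\<omega> \<in> space M. \<forall>n. \<bar>Z (u n) \<omega> - Z 0 \<omega>\<bar> \<le> real (Suc m) * u n powr a}" for m :: nat
  have [measurable]: "E m \<in> events" for m unfolding E_def by measurable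
  have "prob (E m) = 0" for m
  proof -
    have le: "prob (E m) \<le> 2 * real (Suc m) / \<sigma> k * u n powr (a - H k)" for n
    proof -
      have "prob (E m) \<le> prob {\<omega> \<in> space M. \<bar>Z (u n) \<omega> - Z 0 \<omega>\<bar> \<le> real (Suc m) * u n powr a}"
        unfolding E_def by (intro finite_measure_mono) auto
      also have "\<dots> \<le> 2 * (real (Suc m) * u n powr a) / (\<sigma> k * \<bar>u n - 0\<bar> powr H k)"
        using u[of n] by (intro increment_small_ball) auto
      also have "\<dots> = 2 * real (Suc m) / \<sigma> k * u n powr (a - H k)"
        using u[of n] by (simp add: powr_diff)
      finally show ?thesis .
    qed
    have "u \<longlonglongrightarrow> 0"
      using tendsto_mult[OF tendsto_const[of T] LIMSEQ_realpow_zero[of "1/2"]]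
      by (simp add: u_def[abs_def] power_one_over)
    then have "(\<lambda>n. u n powr (a - H k)) \<longlonglongrightarrow> 0"
      using u a by (intro tendsto_zero_powrI[OF _ tendsto_const]) (auto intro!: always_eventually less_imp_le)
    then have "(\<lambda>n. 2 * real (Suc m) / \<sigma> k * u n powr (a - H k)) \<longlonglongrightarrow> 0"
      by (rule tendsto_mult_right_zero)
    then have "prob (E m) \<le> 0" by (rule LIMSEQ_le_const) (use le in blast)
    then show ?thesis using measure_nonneg[of M "E m"] by linarith
  qed
  then have "AE \<omega> in M. \<omega> \<notin> E m" for m
    by (intro AE_not_in) (simp add: null_sets_def emeasure_eq_measure)
  then have "AE \<omega> in M. \<forall>m. \<omega> \<notin> E m" by (simp add: AE_all_countable)
  then show ?thesis
  proof (rule AE_mp, intro AE_I2 impI notI)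
    fix \<omega> assume \<omega>: "\<omega> \<in> space M" "\<forall>m. \<omega> \<notin> E m" "holder_on a {0..T} (\<lambda>t. Z t \<omega>)"
    obtain K where K: "\<And>s t. s \<in> {0..T} \<Longrightarrow> t \<in> {0..T} \<Longrightarrow> \<bar>Z t \<omega> - Z s \<omega>\<bar> \<le> K * \<bar>t - s\<bar> powr a"
      using \<omega>(3) by (rule holder_onE) blast
    obtain m :: nat where m: "K < real m" using reals_Archimedean2 by blast
    have "\<bar>Z (u n) \<omega> - Z 0 \<omega>\<bar> \<le> real (Suc m) * u n powr a" for n
    proof -
      have "\<bar>Z (u n) \<omega> - Z 0 \<omega>\<bar> \<le> K * u n powr a" using K[of 0 "u n"] u[of n] T by simp
      also have "\<dots> \<le> real (Suc m) * u n powr a" using m by (intro mult_right_mono) auto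
      finally show ?thesis .
    qed
    then have "\<omega> \<in> E m" using \<omega>(1) by (simp add: E_def)
    then show False using \<omega>(2) by simp
  qed
qed

text \<open>The exceptional null sets depend on the exponent. Countably many exponents are treated,
  approaching \<open>h\<close> from below and each \<open>H k\<close> from above, and monotonicity
  gives the others.\<close>

lemma AE_holder_exponents:
  assumes T: "0 < T"
  shows "AE \<omega> in M. (\<forall>a. 0 < a \<and> a < h \<longrightarrow> holder_on a {0..T} (\<lambda>t. Z t \<omega>)) \<and>
    (\<forall>a. h < a \<longrightarrow> \<not> holder_on a {0..T} (\<lambda>t. Z t \<omega>))"
proof -
  \<comment> \<open>The shift by 2 keeps these exponents positive, at least
    \<open>h / 2\<close>.\<close>
  have "AE \<omega> in M. holder_on (h - h / real (n + 2)) {0..T} (\<lambda>t. Z t \<omega>)" for n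
  proof -
    have "h / real (n + 2) < h / 1" using h_pos by (intro divide_strict_left_mono) auto
    then show ?thesis using h_pos by (intro AE_holder_on T) auto
  qed
  then have "AE \<omega> in M. \<forall>n::nat. holder_on (h - h / real (n + 2)) {0..T} (\<lambda>t. Z t \<omega>)"
    unfolding AE_all_countable ..
  moreover have "AE \<omega> in M. \<not> holder_on (H k + 1 / real (Suc n)) {0..T} (\<lambda>t. Z t \<omega>)" for k n
    by (rule AE_not_holder_on[OF T, of k]) simp
  then have "AE \<omega> in M. \<forall>k. \<forall>n::nat. \<not> holder_on (H k + 1 / real (Suc n)) {0..T} (\<lambda>t. Z t \<omega>)"
    unfolding AE_all_countable by blast
  ultimately show ?thesis
  proof eventually_elim
    case (elim \<omega>)
    show ?case
    proof (intro conjI allI impI)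
      fix a assume a: "0 < a \<and> a < h"
      obtain n :: nat where n: "h / (h - a) < real n" using reals_Archimedean2 by blast
      have "h < (h - a) * real n" using n a by (simp add: divide_less_eq mult.commute)
      also have "\<dots> \<le> (h - a) * real (n + 2)" using a by (intro mult_left_mono) auto
      finally have "h / real (n + 2) \<le> h - a" by (simp add: divide_le_eq)
      then show "holder_on a {0..T} (\<lambda>t. Z t \<omega>)"
        by (intro holder_on_mono[OF elim(1)[rule_format, of n] T]) simp
    next
      fix a assume "h < a"
      then obtain k where k: "H k < a"
        using cINF_less_iff[OF UNIV_not_empty bdd_below_H, of a] by auto
      obtain n :: nat where n: "1 / real (Suc n) < a - H k"
        using k reals_Archimedean[of "a - H k"] by (auto simp: inverse_eq_divide)
      show "\<not> holder_on a {0..T} (\<lambda>t. Z t \<omega>)"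
        using elim(2) n holder_on_mono[OF _ T, of a "\<lambda>t. Z t \<omega>" "H k + 1 / real (Suc n)"]
        by (auto simp del: of_nat_Suc)
    qed
  qed
qed

end

subsection \<open>Multi-mixed fractional Ornstein--Uhlenbeck process\<close>

text \<open>If \<open>e\<^sup>l\<^sup>s x\<^sub>s\<close> is not integrable on \<open>(-\<infinity>, 0]\<close>, the Bochner integral takes its junk value
  \<open>0\<close> for every \<open>t \<ge> 0\<close>, which is Lipschitz too.\<close>

lemma exp_weighted_integral_lipschitz:
  fixes x :: "real \<Rightarrow> real"
  assumes l: "0 < l" and cont: "continuous_on UNIV x"
  shows "\<exists>L. L-lipschitz_on {0..T} (\<lambda>t. LINT s:{..t}|lborel. exp (- l * (t - s)) * x s)"
proof -
  define g where "g s = exp (l * s) * x s" for s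
  have g: "continuous_on S g" for S
    unfolding g_def by (intro continuous_intros continuous_on_subset[OF cont]) auto
  define J where "J t = (LINT s:{..t}|lborel. g s)" for t
  \<comment> \<open>Factoring out \<open>exp (- l * t)\<close> leaves an integral whose integrand no
    longer depends on \<open>t\<close>, so its increments are integrals of \<open>g\<close> over
    bounded intervals.\<close>
  have eq: "(LINT s:{..t}|lborel. exp (- l * (t - s)) * x s) = exp (- l * t) * J t" for t
  proof -
    have "exp (- l * (t - s)) = exp (- l * t) * exp (l * s)" for s
      by (simp add: exp_add[symmetric] right_diff_distrib)
    then show ?thesis unfolding J_def g_def by (simp add: mult.assoc)
  qed
  show ?thesis
  proof (cases "set_integrable lborel {..0} g")
    case False
    have "J t = 0" if "t \<in> {0..T}" for t
    proof -
      have "\<not> set_integrable lborel {..t} g"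
        using False that set_integrable_subset[of lborel "{..t}" g "{..0}"] by auto
      then show ?thesis
        unfolding J_def set_lebesgue_integral_def set_integrable_def
        by (rule not_integrable_integral_eq)
    qed
    then have "0-lipschitz_on {0..T} (\<lambda>t. exp (- l * t) * J t)" by (intro lipschitz_onI) auto
    then show ?thesis unfolding eq by blast
  next
    case True
    have "bounded (g ` {0..T})" by (intro compact_imp_bounded compact_continuous_image g) simp
    then obtain G where G: "0 < G" "\<And>s. s \<in> {0..T} \<Longrightarrow> \<bar>g s\<bar> \<le> G"
      unfolding bounded_pos by auto
    have int: "set_integrable lborel {s<..t} g" for s t
      by (rule set_integrable_subset[OF borel_integrable_atLeastAtMost'[OF g, of s t]]) auto
    have int': "set_integrable lborel {..t} g" if "0 \<le> t" for t
    proof -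
      have "{..t} = {..0} \<union> {0<..t}" using that by auto
      then show ?thesis using set_integrable_Un[OF True int[of 0 t]] by simp
    qed
    have incr: "\<bar>J t - J s\<bar> \<le> G * (t - s)" if "0 \<le> s" "s \<le> t" "t \<le> T" for s t
    proof -
      have "{..t} = {..s} \<union> {s<..t}" using that by auto
      then have "J t = J s + (LINT r:{s<..t}|lborel. g r)"
        unfolding J_def using set_integral_Un[OF _ int'[of s] int[of s t]] that by force
      also have "\<bar>\<dots> - J s\<bar> \<le> (LINT r:{s<..t}|lborel. \<bar>g r\<bar>)"
        using set_integral_norm_bound[OF int[of s t]] by simp
      also have "\<dots> \<le> (LINT r:{s<..t}|lborel. G)"
        using that G int[of s t]
        by (intro set_integral_mono set_integrable_abs) (auto simp: set_integrable_def)
      also have "\<dots> = G * (t - s)" using that by (simp add: set_lebesgue_integral_def)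
      finally show ?thesis .
    qed
    \<comment> \<open>Product estimate on \<open>[0, T]\<close>: \<open>G\<close> is a Lipschitz
      constant of \<open>J\<close> and the exponential is at most 1; the bracket bounds
      \<open>J\<close>, and \<open>l\<close> is a Lipschitz constant of the exponential.\<close>
    define L where "L = G + (\<bar>J 0\<bar> + G * T) * l"
    have main: "\<bar>exp (- l * t) * J t - exp (- l * s) * J s\<bar> \<le> L * \<bar>t - s\<bar>"
      if st: "0 \<le> s" "s \<le> t" "t \<le> T" for s t
    proof -
      have Js: "\<bar>J s\<bar> \<le> \<bar>J 0\<bar> + G * T"
      proof -
        have "G * s \<le> G * T" using G(1) st by (intro mult_left_mono) auto
        then show ?thesis using incr[of 0 s] st by simp
      qed
      have e: "\<bar>exp (- l * t) - exp (- l * s)\<bar> \<le> l * (t - s)"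
      proof -
        have "exp (- l * t) = exp (- l * s) * exp (- l * (t - s))"
          by (simp add: exp_add[symmetric] right_diff_distrib)
        then have "exp (- l * s) - exp (- l * t) = exp (- l * s) * (1 - exp (- l * (t - s)))"
          by (simp add: right_diff_distrib)
        also have "\<dots> \<le> 1 * (l * (t - s))"
          using l st exp_ge_add_one_self[of "- l * (t - s)"] by (intro mult_mono) auto
        finally show ?thesis using l st by simp
      qed
      have "exp (- l * t) * J t - exp (- l * s) * J s =
          exp (- l * t) * (J t - J s) + J s * (exp (- l * t) - exp (- l * s))"
        by (simp add: algebra_simps)
      also have "\<bar>\<dots>\<bar> \<le> exp (- l * t) * \<bar>J t - J s\<bar> + \<bar>J s\<bar> * \<bar>exp (- l * t) - exp (- l * s)\<bar>"
        by (rule order_trans[OF abs_triangle_ineq]) (simp add: abs_mult)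
      also have "\<dots> \<le> 1 * (G * (t - s)) + (\<bar>J 0\<bar> + G * T) * (l * (t - s))"
        using incr[OF st] Js e l st G(1) by (intro add_mono mult_mono) auto
      also have "\<dots> = L * \<bar>t - s\<bar>" using st by (simp add: L_def algebra_simps)
      finally show ?thesis .
    qed
    show ?thesis
    proof (cases "0 \<le> T")
      case True
      then have "0 \<le> L" unfolding L_def using G(1) l by (intro add_nonneg_nonneg mult_nonneg_nonneg) auto
      moreover have "\<bar>exp (- l * t) * J t - exp (- l * s) * J s\<bar> \<le> L * \<bar>t - s\<bar>"
        if "s \<in> {0..T}" "t \<in> {0..T}" for s t
        using main[of s t] main[of t s] that by (cases "s \<le> t") (auto simp: abs_minus_commute)
      ultimately have "L-lipschitz_on {0..T} (\<lambda>t. exp (- l * t) * J t)"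
        by (intro lipschitz_onI) (auto simp: dist_real_def)
      then show ?thesis unfolding eq by blast
    next
      case False
      then show ?thesis by (intro exI[of _ 0]) simp
    qed
  qed
qed

theorem theorem4p1:
  fixes P :: "'a measure"
    and \<sigma> H :: "nat \<Rightarrow> real"
    and B :: "nat \<Rightarrow> real \<Rightarrow> 'a \<Rightarrow> real"
    and M U :: "real \<Rightarrow> 'a \<Rightarrow> real"
    and l T :: real
  assumes "prob_space P"
    and "mmfBm P \<sigma> H B M"
    and "0 < l"
    and "U = mmfOU l M"
    and "0 < T"
  shows "AE \<omega> in P. holder_index T (\<lambda>t. M t \<omega>) = ereal (INF k. H k) \<and>
                    holder_index T (\<lambda>t. U t \<omega>) = ereal (INF k. H k)"
proof -
  interpret mmfBm_process P \<sigma> H B M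
    using assms(1,2) by (simp add: mmfBm_process_def mmfBm_process_axioms_def)
  show ?thesis
    using AE_holder_exponents[OF \<open>0 < T\<close>]
  proof (rule AE_mp, intro AE_I2 impI)
    fix \<omega> assume \<omega>: "\<omega> \<in> space P" and
      ex: "(\<forall>a. 0 < a \<and> a < h \<longrightarrow> holder_on a {0..T} (\<lambda>t. M t \<omega>)) \<and>
        (\<forall>a. h < a \<longrightarrow> \<not> holder_on a {0..T} (\<lambda>t. M t \<omega>))"
    obtain L where "L-lipschitz_on {0..T} (\<lambda>t. LINT s:{..t}|lborel. exp (- l * (t - s)) * M s \<omega>)"
      using exp_weighted_integral_lipschitz[OF \<open>0 < l\<close> continuous_Z[OF \<omega>]] by blast
    then have "(\<bar>- l\<bar> * L)-lipschitz_on {0..T}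
        (\<lambda>t. - l * (LINT s:{..t}|lborel. exp (- l * (t - s)) * M s \<omega>))"
      by (rule lipschitz_on_cmult_real)
    then have "holder_index T (\<lambda>t. M t \<omega> + - l * (LINT s:{..t}|lborel. exp (- l * (t - s)) * M s \<omega>)) = ereal h"
      using ex by (intro holder_index_add_lipschitz \<open>0 < T\<close> h_pos h_less_1) blast+
    then have "holder_index T (\<lambda>t. U t \<omega>) = ereal h"
      by (simp add: assms(4) mmfOU_def)
    moreover have "holder_index T (\<lambda>t. M t \<omega>) = ereal h"
      using ex by (intro holder_index_eqI h_pos) blast+
    ultimately show "holder_index T (\<lambda>t. M t \<omega>) = ereal h \<and> holder_index T (\<lambda>t. U t \<omega>) = ereal h"
      by simp
  qed
qed

end
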